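(* Let $H\in\mathbb{C}^{n\times n}$ be an invertible Hermitian matrix and let $B_0\in\mathbb{C}^{n\times n}$ be a nilpotent $H$-nonnegative matrix. Then the following are equivalent: (i) $B_0$ has a square root; (ii) there exists a Segre pairing of $B_0$; (iii) in the Segre characteristic of $B_0$, either there is an even number of entries equal to $2$, or there is an odd number of entries equal to $2$ and at least one entry equal to $1$.
   Context: With $(\cdot,\cdot)$ the Euclidean inner product on $\mathbb{C}^n$ and $[x,y]=(Hx,y)$, a matrix $B\in\mathbb{C}^{n\times n}$ is $H$-nonnegative if $[Bx,x]\ge 0$ for all $x\in\mathbb{C}^n$. A square root of $B$ is a matrix $A\in\mathbb{C}^{n\times n}$ (no additional structure required) with $A^2=B$. The Segre characteristic of a nilpotent matrix $B_0$ is the list $(n_1,\ldots,n_r)$ of the sizes of the Jordan blocks of $B_0$ (all at eigenvalue $0$), in decreasing order. (For a nilpotent $H$-nonnegative matrix all $n_i\in\{1,2\}$.) A Segre pairing of $B_0$ is a finite collection (with repetitions allowed, arranged lexicographically) of pairs of numbers from $\{n_1,\ldots,n_r\}\cup\{0\}$ such that: each entry $n_i$ of the Segre characteristic (entries counted with multiplicity) appears in one and only one pair; each pair consists either of two entries of the Segre characteristic or of one entry of the Segre characteristic and one zero, with first entry greater than or equal to the second; and the absolute difference between the two entries of each pair is at most one. *)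

theory Defs
  imports "Jordan_Normal_Form.Jordan_Normal_Form_Existence"
    "Jordan_Normal_Form.Jordan_Normal_Form_Uniqueness"
begin

definition hermitian_mat :: "complex mat \<Rightarrow> bool" where
  "hermitian_mat H \<longleftrightarrow> square_mat H \<and> mat_adjoint H = H"

text \<open>The form $[x,y] = (Hx,y)$; as \<open>\<bullet>c\<close> conjugates its right argument, the
  Euclidean inner product is linear in its first argument.\<close>

definition indef_inner :: "complex mat \<Rightarrow> complex vec \<Rightarrow> complex vec \<Rightarrow> complex" where
  "indef_inner H x y = (H *\<^sub>v x) \<bullet>c y"

text \<open>The order on the complex numbers is the one of \<open>HOL-Library.Complex_Order\<close>: \<open>0 \<le> z\<close>
  says that \<open>z\<close> is real and nonnegative.\<close>

definition H_nonnegative :: "complex mat \<Rightarrow> complex mat \<Rightarrow> bool" where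
  "H_nonnegative H B \<longleftrightarrow>
     (\<forall>x \<in> carrier_vec (dim_row H). 0 \<le> indef_inner H (B *\<^sub>v x) x)"

definition nilpotent_mat :: "complex mat \<Rightarrow> bool" where
  "nilpotent_mat B \<longleftrightarrow>
     square_mat B \<and> (\<exists>k. B ^\<^sub>m k = 0\<^sub>m (dim_row B) (dim_row B))"

definition is_square_root :: "complex mat \<Rightarrow> complex mat \<Rightarrow> bool" where
  "is_square_root A B \<longleftrightarrow> A \<in> carrier_mat (dim_row B) (dim_row B) \<and> A ^\<^sub>m 2 = B"

text \<open>The sizes of all Jordan blocks; for a nilpotent matrix all blocks belong to the
  eigenvalue \<open>0\<close>. Well defined by \<open>segre_characteristic_exists\<close> and
  \<open>segre_characteristic_eq\<close> below.\<close>

definition segre_characteristic :: "complex mat \<Rightarrow> nat list" where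
  "segre_characteristic B =
     (THE ns. \<exists>n_as. jordan_nf B n_as \<and> ns = rev (sort (map fst n_as)))"

text \<open>A Segre pairing, a finite collection with repetitions arranged lexicographically, is a list
  of pairs in decreasing lexicographic order, in line with the decreasing order of the Segre
  characteristic. Since \<open>0\<close> is never an entry of the Segre characteristic, the last
  conjunct says that each entry, counted with multiplicity, is used exactly once.\<close>

definition segre_pairing :: "complex mat \<Rightarrow> (nat \<times> nat) list \<Rightarrow> bool" where
  "segre_pairing B ps \<longleftrightarrow>
     (let ns = segre_characteristic B in
       sorted_wrt (\<lambda>(a, b) (c, d). a > c \<or> a = c \<and> b \<ge> d) ps \<and>
       (\<forall>(a, b) \<in> set ps.
          a \<in> set ns \<and> (b \<in> set ns \<or> b = 0) \<and> a \<ge> b \<and> \<bar>int a - int b\<bar> \<le> 1) \<and>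
       mset (filter (\<lambda>k. k \<noteq> 0) (map fst ps @ map snd ps)) = mset ns)"

lemma jordan_nf_unique_mset:
  assumes "jordan_nf (B :: complex mat) n_as" "jordan_nf B m_bs"
  shows "mset n_as = mset m_bs"
proof (rule multiset_eqI)
  fix p :: "nat \<times> complex"
  obtain k ev where p: "p = (k, ev)" by force
  have nz: "(0, ev) \<notin> set ls" if "jordan_nf B ls" for ls
    using that unfolding jordan_nf_def by force
  have cnt: "count (mset ls) (k, ev) = length (filter ((=) (k, ev)) ls)"
    for ls :: "(nat \<times> complex) list"
    by (induct ls) auto
  show "count (mset n_as) p = count (mset m_bs) p"
  proof (cases "k = 0")
    case True
    then show ?thesis using nz[OF assms(1)] nz[OF assms(2)] p by (metis count_mset_0_iff)
  next
    case False
    then show ?thesis unfolding p cnt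
      using compute_nr_of_jordan_blocks[OF assms(1), of k ev]
        compute_nr_of_jordan_blocks[OF assms(2), of k ev] by simp
  qed
qed

lemma segre_characteristic_exists:
  assumes "B \<in> carrier_mat n n"
  shows "\<exists>n_as. jordan_nf (B :: complex mat) n_as"
  using char_poly_factorized[OF assms] jordan_nf_exists[OF assms] by blast

lemma segre_characteristic_eq:
  assumes "jordan_nf B n_as"
  shows "segre_characteristic B = rev (sort (map fst n_as))"
  unfolding segre_characteristic_def
proof (rule the_equality)
  show "\<exists>m_bs. jordan_nf B m_bs \<and> rev (sort (map fst n_as)) = rev (sort (map fst m_bs))"
    using assms by blast
next
  fix ns
  assume "\<exists>m_bs. jordan_nf B m_bs \<and> ns = rev (sort (map fst m_bs))"
  then obtain m_bs where m: "jordan_nf B m_bs" "ns = rev (sort (map fst m_bs))" by blast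
  have "mset (map fst m_bs) = mset (map fst n_as)"
    using jordan_nf_unique_mset[OF m(1) assms] by simp
  then have "sort (map fst m_bs) = sort (map fst n_as)"
    by (intro properties_for_sort) simp_all
  then show "ns = rev (sort (map fst n_as))" using m(2) by simp
qed

end

theory Submission
  imports Defs
begin

text \<open>
  Write \<open>G = H B\<close>. Nonnegativity makes \<open>G\<close> positive semidefinite, and \<open>H\<close> being Hermitian makes
  \<open>B\<close> selfadjoint for \<open>[\<cdot>,\<cdot>]\<close>. If \<open>B\<^sup>3 w = 0\<close>, then \<open>y = B w\<close> satisfies
  \<open>[B y, y] = [B\<^sup>2 y, w] = 0\<close>, so \<open>y\<close> is a null vector of \<open>G\<close>, and \<open>B y = 0\<close> since \<open>H\<close> is
  invertible. A nilpotent \<open>B\<close> therefore has square zero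
  (\<open>nilpotent_H_nonnegative_square_zero\<close>). Hence \<open>B\<close> has \<open>p\<close> Jordan blocks of
  size 2 and \<open>q\<close> of size 1, all for the eigenvalue 0, with \<open>n = 2p + q\<close> and
  \<open>dim ker B = p + q\<close>. These two equations determine \<open>p\<close> and \<open>q\<close>, so square-zero matrices
  of the same size and with kernels of the same dimension are similar
  (\<open>square_zero_similar\<close>).

  The squares of the nilpotent blocks of sizes
  4, 3 and 1 have Jordan types \<open>(2,2)\<close>, \<open>(2,1)\<close> and \<open>(1)\<close>. If \<open>p\<close> is even, or \<open>p\<close> is odd and \<open>q\<close> is
  positive, then \<open>p\<close> twos and \<open>q\<close> ones can be grouped into such types; the square of the
  corresponding direct sum has the size and the kernel dimension of \<open>B\<close>, hence is similar to \<open>B\<close>.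

  If \<open>A\<^sup>2 = B\<close>, then \<open>A\<^sup>4 = 0\<close>, so the Jordan blocks of \<open>A\<close> have sizes
  \<open>m\<^sub>1, \<dots>, m\<^sub>r \<le> 4\<close>, and \<open>dim ker B = \<Sum> min 2 m\<^sub>i\<close>. When \<open>q = 0\<close> this sum is
  \<open>p = n/2\<close>, so \<open>\<Sum> m\<^sub>i = 2 \<Sum> min 2 m\<^sub>i\<close>. As \<open>m \<le> 2 min 2 m\<close> for \<open>m \<le> 4\<close>, strictly
  unless \<open>m\<close> is 0 or 4, every block of \<open>A\<close> has size 4; thus 4 divides \<open>n = 2p\<close> and \<open>p\<close> is even.

  A Segre pairing is the same grouping of the entries. Only the pairs \<open>(2,2)\<close>, \<open>(2,1)\<close>,
  \<open>(1,1)\<close>, \<open>(1,0)\<close> can occur, so without ones the twos are matched among themselves. Existence of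
  a pairing thus depends on \<open>p\<close> and \<open>q\<close> through the same parity condition
  (\<open>segre_pairing_iff_parity\<close>).
\<close>

section \<open>Nilpotent nonnegative matrices have square zero\<close>

lemma hermitian_mat_index:
  assumes "H \<in> carrier_mat n n" "hermitian_mat H" "i < n" "j < n"
  shows "H $$ (i, j) = cnj (H $$ (j, i))"
proof -
  have "H $$ (i, j) = mat_adjoint H $$ (i, j)"
    using assms(2) by (simp add: hermitian_mat_def)
  also have "\<dots> = cnj (H $$ (j, i))"
    using assms(1,3,4) by (simp add: mat_adjoint_def mat_of_rows_def)
  finally show ?thesis .
qed

lemma hermitian_mat_adjoint:
  assumes H: "H \<in> carrier_mat n n" "hermitian_mat H"
    and x: "x \<in> carrier_vec n" and y: "y \<in> carrier_vec n"
  shows "(H *\<^sub>v x) \<bullet>c y = cnj ((H *\<^sub>v y) \<bullet>c x)"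
proof -
  have "(H *\<^sub>v x) \<bullet>c y = (\<Sum>i<n. \<Sum>j<n. H $$ (i, j) * x $ j * cnj (y $ i))"
    using H(1) x y
    by (simp add: scalar_prod_def mult_mat_vec_def sum_distrib_right lessThan_atLeast0)
  also have "\<dots> = (\<Sum>j<n. \<Sum>i<n. H $$ (i, j) * x $ j * cnj (y $ i))"
    by (rule sum.swap)
  also have "\<dots> = (\<Sum>j<n. \<Sum>i<n. cnj (H $$ (j, i) * y $ i * cnj (x $ j)))"
  proof (intro sum.cong refl)
    fix i j assume "j \<in> {..<n}" "i \<in> {..<n}"
    then have "H $$ (i, j) = cnj (H $$ (j, i))" by (intro hermitian_mat_index[OF H]) auto
    then show "H $$ (i, j) * x $ j * cnj (y $ i) = cnj (H $$ (j, i) * y $ i * cnj (x $ j))"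
      by (simp only: complex_cnj_mult complex_cnj_cnj mult_ac)
  qed
  also have "\<dots> = cnj ((H *\<^sub>v y) \<bullet>c x)"
    using H(1) x y
    by (simp add: scalar_prod_def mult_mat_vec_def sum_distrib_right lessThan_atLeast0)
  finally show ?thesis .
qed

text \<open>Expanding along a line \<open>x + t y\<close> lets the positivity of the quadratic form, applied to
  well-chosen \<open>t\<close>, give information on the mixed terms.\<close>
lemma sesquilinear_expand:
  fixes G :: "complex mat"
  assumes G: "G \<in> carrier_mat n n" and x: "x \<in> carrier_vec n" and y: "y \<in> carrier_vec n"
  shows "(G *\<^sub>v (x + t \<cdot>\<^sub>v y)) \<bullet>c (x + t \<cdot>\<^sub>v y) =
    (G *\<^sub>v x) \<bullet>c x + cnj t * ((G *\<^sub>v x) \<bullet>c y) + t * ((G *\<^sub>v y) \<bullet>c x)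
      + t * cnj t * ((G *\<^sub>v y) \<bullet>c y)"
proof -
  have "G *\<^sub>v (x + t \<cdot>\<^sub>v y) = G *\<^sub>v x + t \<cdot>\<^sub>v (G *\<^sub>v y)"
    using assms by (simp add: mult_add_distrib_mat_vec mult_mat_vec)
  moreover have "conjugate (x + t \<cdot>\<^sub>v y) = conjugate x + cnj t \<cdot>\<^sub>v conjugate y"
    using x y by (simp add: conjugate_add_vec[of _ n] conjugate_smult_vec)
  moreover have "G *\<^sub>v x \<in> carrier_vec n" "G *\<^sub>v y \<in> carrier_vec n" using assms by auto
  moreover have "(u + t \<cdot>\<^sub>v v) \<bullet> (p + s \<cdot>\<^sub>v q) = u \<bullet> p + s * (u \<bullet> q) + t * (v \<bullet> p) + t * s * (v \<bullet> q)"
    if "u \<in> carrier_vec n" "v \<in> carrier_vec n" "p \<in> carrier_vec n" "q \<in> carrier_vec n"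
    for u v p q :: "complex vec" and s
  proof -
    have "(u + t \<cdot>\<^sub>v v) \<bullet> (p + s \<cdot>\<^sub>v q) =
        u \<bullet> (p + s \<cdot>\<^sub>v q) + (t \<cdot>\<^sub>v v) \<bullet> (p + s \<cdot>\<^sub>v q)"
      using that by (intro add_scalar_prod_distrib[of _ n]) auto
    also have "u \<bullet> (p + s \<cdot>\<^sub>v q) = u \<bullet> p + u \<bullet> (s \<cdot>\<^sub>v q)"
      using that by (intro scalar_prod_add_distrib[of _ n]) auto
    also have "(t \<cdot>\<^sub>v v) \<bullet> (p + s \<cdot>\<^sub>v q) = (t \<cdot>\<^sub>v v) \<bullet> p + (t \<cdot>\<^sub>v v) \<bullet> (s \<cdot>\<^sub>v q)"
      using that by (intro scalar_prod_add_distrib[of _ n]) auto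
    finally show ?thesis using that by (simp add: algebra_simps)
  qed
  ultimately show ?thesis using x y carrier_vec_conjugate by metis
qed

text \<open>The form is real on \<open>x + t y\<close>, so the mixed terms have vanishing imaginary part for every
  \<open>t\<close>. The values \<open>t = 1\<close> and \<open>t = \<i>\<close> compare the imaginary and the real parts of the two sides.\<close>
lemma positive_semidefinite_symmetric:
  fixes G :: "complex mat"
  assumes G: "G \<in> carrier_mat n n"
    and pos: "\<And>x. x \<in> carrier_vec n \<Longrightarrow> 0 \<le> (G *\<^sub>v x) \<bullet>c x"
    and x: "x \<in> carrier_vec n" and y: "y \<in> carrier_vec n"
  shows "(G *\<^sub>v y) \<bullet>c x = cnj ((G *\<^sub>v x) \<bullet>c y)"
proof -
  have im: "Im (cnj t * ((G *\<^sub>v x) \<bullet>c y) + t * ((G *\<^sub>v y) \<bullet>c x)) = 0" for t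
    using pos[of "x + t \<cdot>\<^sub>v y"] pos[OF x] pos[OF y] x y
    by (simp add: sesquilinear_expand[OF G x y] less_eq_complex_def)
  show ?thesis using im[of 1] im[of "\<i>"] by (simp add: complex_eq_iff)
qed

text \<open>At a null vector the quadratic form attains its minimum, so its first-order variation vanishes
  in every direction; the direction \<open>G x\<close> gives \<open>\<bar>G x\<bar>\<^sup>2 = 0\<close>.\<close>
lemma positive_semidefinite_null_vector:
  fixes G :: "complex mat"
  assumes G: "G \<in> carrier_mat n n"
    and pos: "\<And>x. x \<in> carrier_vec n \<Longrightarrow> 0 \<le> (G *\<^sub>v x) \<bullet>c x"
    and x: "x \<in> carrier_vec n" and null: "(G *\<^sub>v x) \<bullet>c x = 0"
  shows "G *\<^sub>v x = 0\<^sub>v n"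
proof -
  let ?y = "G *\<^sub>v x"
  have y: "?y \<in> carrier_vec n" using G x by auto
  define a where "a = Re (?y \<bullet>c ?y)"
  define b where "b = Re ((G *\<^sub>v ?y) \<bullet>c ?y)"
  have yy: "0 \<le> ?y \<bullet>c ?y" by (rule conjugate_square_ge_0_vec)
  have a: "?y \<bullet>c ?y = of_real a" "a \<ge> 0"
    using yy by (auto simp: a_def less_eq_complex_def complex_eq_iff)
  have b: "(G *\<^sub>v ?y) \<bullet>c ?y = of_real b" "b \<ge> 0"
    using pos[OF y] by (auto simp: b_def less_eq_complex_def complex_eq_iff)
  have sym: "(G *\<^sub>v ?y) \<bullet>c x = of_real a"
    using positive_semidefinite_symmetric[OF G pos x y] a by simp
  have "a = 0"
  proof (rule ccontr)
    assume "a \<noteq> 0"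
    \<comment> \<open>Along \<open>x - s G x\<close> the form equals \<open>s (s b - 2 a)\<close>, negative as soon as \<open>s b < a\<close>.\<close>
    define s where "s = a / (b + 1)"
    have s: "s > 0" "s * b < a" using a b \<open>a \<noteq> 0\<close> by (auto simp: s_def field_simps)
    have "0 \<le> Re ((G *\<^sub>v (x + of_real (-s) \<cdot>\<^sub>v ?y)) \<bullet>c (x + of_real (-s) \<cdot>\<^sub>v ?y))"
      using pos[of "x + of_real (-s) \<cdot>\<^sub>v ?y"] x y by (simp add: less_eq_complex_def)
    then have "0 \<le> s * (s * b - 2 * a)"
      unfolding sesquilinear_expand[OF G x y] null sym a(1) b(1)
      by (simp add: algebra_simps)
    then show False using s a(2) by (simp add: zero_le_mult_iff)
  qed
  then show ?thesis using a(1) y by simp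
qed

lemma mult_mat_zero_vec:
  fixes A :: "'a :: comm_ring_1 mat"
  shows "A \<in> carrier_mat n m \<Longrightarrow> A *\<^sub>v 0\<^sub>v m = 0\<^sub>v n"
  by (intro eq_vecI) auto

lemma mat_eq_zeroI:
  fixes A :: "'a :: comm_ring_1 mat"
  assumes A: "A \<in> carrier_mat n m"
    and zero: "\<And>x. x \<in> carrier_vec m \<Longrightarrow> A *\<^sub>v x = 0\<^sub>v n"
  shows "A = 0\<^sub>m n m"
proof (rule eq_matI)
  fix i j assume "i < dim_row (0\<^sub>m n m)" "j < dim_col (0\<^sub>m n m)"
  then have ij: "i < n" "j < m" by auto
  have "A $$ (i, j) = (A *\<^sub>v unit_vec m j) $ i" using A ij by simp
  then show "A $$ (i, j) = 0\<^sub>m n m $$ (i, j)" using ij zero by simp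
qed (use A in auto)

text \<open>With \<open>y = B w\<close>, selfadjointness of \<open>B\<close> gives \<open>[B y, y] = [B\<^sup>2 y, w] = [B\<^sup>3 w, w] = 0\<close>.
  Thus \<open>y\<close> is a null vector of the positive semidefinite \<open>H B\<close>, and \<open>H\<close> can be cancelled.\<close>
lemma H_nonnegative_kernel_cube:
  assumes H: "H \<in> carrier_mat n n" "invertible_mat H" "hermitian_mat H"
    and B: "B \<in> carrier_mat n n" "H_nonnegative H B"
    and w: "w \<in> carrier_vec n" and cube: "B *\<^sub>v (B *\<^sub>v (B *\<^sub>v w)) = 0\<^sub>v n"
  shows "B *\<^sub>v (B *\<^sub>v w) = 0\<^sub>v n"
proof -
  let ?G = "H * B"
  have G: "?G \<in> carrier_mat n n" using H B by auto
  have G_app: "?G *\<^sub>v x = H *\<^sub>v (B *\<^sub>v x)" if "x \<in> carrier_vec n" for x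
    using H B that by simp
  have Bc: "B *\<^sub>v x \<in> carrier_vec n" if "x \<in> carrier_vec n" for x using B(1) that by simp
  have pos: "0 \<le> (?G *\<^sub>v x) \<bullet>c x" if "x \<in> carrier_vec n" for x
    using B(2) H(1) that by (simp add: H_nonnegative_def indef_inner_def G_app)
  let ?y = "B *\<^sub>v w"
  have y: "?y \<in> carrier_vec n" by (rule Bc[OF w])
  have "(?G *\<^sub>v ?y) \<bullet>c ?y = (H *\<^sub>v (B *\<^sub>v ?y)) \<bullet>c (B *\<^sub>v w)"
    using G_app[OF y] by simp
  also have "\<dots> = cnj ((H *\<^sub>v (B *\<^sub>v w)) \<bullet>c (B *\<^sub>v ?y))"
    by (rule hermitian_mat_adjoint[OF H(1,3) Bc[OF y] y])
  also have "\<dots> = (?G *\<^sub>v (B *\<^sub>v ?y)) \<bullet>c w"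
    using positive_semidefinite_symmetric[OF G pos w Bc[OF y]] G_app[OF w] by simp
  also have "\<dots> = 0"
    using cube w H(1) by (simp add: G_app[OF Bc[OF y]] mult_mat_zero_vec)
  finally have "H *\<^sub>v (B *\<^sub>v ?y) = 0\<^sub>v n"
    using positive_semidefinite_null_vector[OF G pos y] G_app[OF y] by simp
  moreover obtain K where K: "K * H = 1\<^sub>m n" "K \<in> carrier_mat n n"
  proof -
    from H(1,2) obtain K where "H * K = 1\<^sub>m n" "K * H = 1\<^sub>m (dim_row K)"
      by (auto simp: invertible_mat_def inverts_mat_def)
    moreover from this have "K \<in> carrier_mat n n"
      using H(1) by (metis carrier_matD(2) carrier_matI index_mult_mat(3) index_one_mat(3))
    ultimately show ?thesis using that by auto
  qed
  ultimately have "K *\<^sub>v (H *\<^sub>v (B *\<^sub>v ?y)) = 0\<^sub>v n"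
    using mult_mat_zero_vec[OF K(2)] by simp
  then have "(K * H) *\<^sub>v (B *\<^sub>v ?y) = 0\<^sub>v n"
    using assoc_mult_mat_vec[OF K(2) H(1) Bc[OF y]] by simp
  then show ?thesis unfolding K(1) using Bc[OF y] by simp
qed

lemma pow_mat_Suc_vec:
  fixes B :: "'a :: comm_semiring_1 mat"
  assumes "B \<in> carrier_mat n n" "x \<in> carrier_vec n"
  shows "B ^\<^sub>m Suc k *\<^sub>v x = B ^\<^sub>m k *\<^sub>v (B *\<^sub>v x)"
  using assms by (simp add: assoc_mult_mat_vec[of _ n n _ n])

text \<open>Cancelling one power of \<open>B\<close> at a time turns \<open>B\<^sup>k x = 0\<close> into \<open>B\<^sup>2 x = 0\<close>.\<close>
lemma nilpotent_H_nonnegative_square_zero: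
  assumes H: "H \<in> carrier_mat n n" "invertible_mat H" "hermitian_mat H"
    and B: "B \<in> carrier_mat n n" "nilpotent_mat B" "H_nonnegative H B"
  shows "B ^\<^sub>m 2 = 0\<^sub>m n n"
proof (rule mat_eq_zeroI)
  have Bc: "B *\<^sub>v x \<in> carrier_vec n" if "x \<in> carrier_vec n" for x using B(1) that by simp
  have sq: "B ^\<^sub>m 2 *\<^sub>v x = B *\<^sub>v (B *\<^sub>v x)" if "x \<in> carrier_vec n" for x
    using B(1) that Bc[OF that] by (simp add: numeral_2_eq_2 assoc_mult_mat_vec[of _ n n _ n])
  have *: "B *\<^sub>v (B *\<^sub>v x) = 0\<^sub>v n" if "x \<in> carrier_vec n" "B ^\<^sub>m k *\<^sub>v x = 0\<^sub>v n" for k x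
    using that
  proof (induction k arbitrary: x)
    case 0
    then show ?case using B(1) by (simp add: mult_mat_zero_vec)
  next
    case (Suc k)
    have "B ^\<^sub>m k *\<^sub>v (B *\<^sub>v x) = 0\<^sub>v n"
      using Suc.prems(2) unfolding pow_mat_Suc_vec[OF B(1) Suc.prems(1)] .
    then have "B *\<^sub>v (B *\<^sub>v (B *\<^sub>v x)) = 0\<^sub>v n"
      by (rule Suc.IH[OF Bc[OF Suc.prems(1)]])
    then show ?case
      by (rule H_nonnegative_kernel_cube[OF H B(1,3) Suc.prems(1)])
  qed
  from B(1,2) obtain k where "B ^\<^sub>m k = 0\<^sub>m n n" by (auto simp: nilpotent_mat_def)
  moreover have "(0\<^sub>m n n :: complex mat) *\<^sub>v x = 0\<^sub>v n" if "x \<in> carrier_vec n" for x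
    using that by (intro eq_vecI) auto
  ultimately show "B ^\<^sub>m 2 *\<^sub>v x = 0\<^sub>v n" if "x \<in> carrier_vec n" for x
    using *[OF that, of k] that sq by simp
qed (use B in simp)

section \<open>The order of diagonal blocks\<close>

lemma similar_four_block_swap:
  fixes A D :: "'a :: comm_ring_1 mat"
  assumes A: "A \<in> carrier_mat n n" and D: "D \<in> carrier_mat m m"
  shows "similar_mat (four_block_mat A (0\<^sub>m n m) (0\<^sub>m m n) D)
    (four_block_mat D (0\<^sub>m m n) (0\<^sub>m n m) A)" (is "similar_mat ?A ?D")
proof -
  let ?P = "four_block_mat (0\<^sub>m n m) (1\<^sub>m n) (1\<^sub>m m) (0\<^sub>m m n) :: 'a mat"
  let ?Q = "four_block_mat (0\<^sub>m m n) (1\<^sub>m m) (1\<^sub>m n) (0\<^sub>m n m) :: 'a mat"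
  have PQ: "?P * ?Q = 1\<^sub>m (n + m)"
    by (subst mult_four_block_mat[of _ n m _ n _ m _ _ n _ m]) auto
  have QP: "?Q * ?P = 1\<^sub>m (n + m)"
    by (subst mult_four_block_mat[of _ m n _ m _ n _ _ m _ n]) (auto simp: add.commute)
  have "?P * ?D = four_block_mat (0\<^sub>m n m) A D (0\<^sub>m m n)"
    using A D by (subst mult_four_block_mat[of _ n m _ n _ m _ _ m _ n]) auto
  then have "?P * ?D * ?Q = ?A"
    using A D by (simp, subst mult_four_block_mat[of _ n m _ n _ m _ _ n _ m]) auto
  then show ?thesis
    using A D PQ QP by (intro similar_matI[of _ _ ?P ?Q "n + m"]) auto
qed

text \<open>Exchanging two consecutive groups of blocks rotates a list, so the block that has to come
  first can be moved to the front; the remaining blocks are handled by induction.\<close>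
lemma similar_diag_block_mat_mset:
  fixes As Bs :: "'a :: comm_ring_1 mat list"
  assumes "mset As = mset Bs" "\<And>A. A \<in> set As \<Longrightarrow> square_mat A"
  shows "similar_mat (diag_block_mat As) (diag_block_mat Bs)"
  using assms
proof (induction As arbitrary: Bs)
  case Nil
  then show ?case by (auto intro!: similar_mat_refl[of _ 0])
next
  case (Cons A As)
  have "A \<in> set Bs" using Cons.prems(1) by (metis list.set_intros(1) set_mset_mset)
  then obtain Cs Ds where Bs: "Bs = Cs @ A # Ds" by (auto simp: in_set_conv_decomp)
  have mset: "mset As = mset (Ds @ Cs)" using Cons.prems(1) unfolding Bs by simp
  have sq: "square_mat X" if "X \<in> set Bs" for X
    using that Cons.prems(2) mset_eq_setD[OF Cons.prems(1)] by blast
  have carrier: "\<exists>k. diag_block_mat Xs \<in> carrier_mat k k" if "set Xs \<subseteq> set Bs" for Xs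
    using diag_block_mat_square[of Xs] that sq
    by (metis carrier_matI square_mat.elims(2) subsetD)
  obtain n where A: "A \<in> carrier_mat n n" using sq[of A] by (intro that[of "dim_row A"]) (auto simp: Bs)
  obtain k where k: "diag_block_mat (Ds @ Cs) \<in> carrier_mat k k"
    using carrier[of "Ds @ Cs"] by (auto simp: Bs)
  obtain l where l: "diag_block_mat (A # Ds) \<in> carrier_mat l l"
    using carrier[of "A # Ds"] by (auto simp: Bs)
  obtain m where m: "diag_block_mat Cs \<in> carrier_mat m m"
    using carrier[of Cs] by (auto simp: Bs)
  have IH: "similar_mat (diag_block_mat As) (diag_block_mat (Ds @ Cs))"
    using Cons.IH[OF mset] Cons.prems(2) by simp
  then have As: "diag_block_mat As \<in> carrier_mat k k"
    using k by (auto dest!: similar_matD)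
  have "similar_mat (diag_block_mat (A # As)) (diag_block_mat (A # Ds @ Cs))"
    using similar_mat_four_block_0_0[OF similar_mat_refl[OF A] IH A As] A As k
    by (simp add: Let_def)
  moreover have "similar_mat (diag_block_mat ((A # Ds) @ Cs)) (diag_block_mat (Cs @ A # Ds))"
    using similar_four_block_swap[OF l m] carrier_matD[OF l] carrier_matD[OF m]
    by (simp only: diag_block_mat_append Let_def)
  ultimately show ?case unfolding Bs append_Cons by (rule similar_mat_trans)
qed

lemma jordan_nf_mset:
  fixes X :: "'a :: comm_ring_1 mat"
  assumes "jordan_nf X n_as" "mset n_as = mset m_bs"
  shows "jordan_nf X m_bs"
proof -
  have "similar_mat (jordan_matrix n_as) (jordan_matrix m_bs)"
    unfolding jordan_matrix_def using assms(2)
    by (intro similar_diag_block_mat_mset) auto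
  then show ?thesis
    using assms mset_eq_setD[OF assms(2)] similar_mat_trans unfolding jordan_nf_def by metis
qed

section \<open>Jordan types of nilpotent matrices via kernel dimensions\<close>

lemma dim_gen_eigenspace_zero:
  assumes "X \<in> carrier_mat n n"
  shows "dim_gen_eigenspace X 0 k = kernel_dim (X ^\<^sub>m k)"
proof -
  have "char_matrix X 0 = X" using assms by (auto simp: char_matrix_def intro!: eq_matI)
  then show ?thesis by (simp add: dim_gen_eigenspace_def)
qed

lemma kernel_dim_zero_mat: "kernel_dim (0\<^sub>m n n :: 'a :: field mat) = n"
proof -
  have "jordan_block n (0 :: 'a) ^\<^sub>m n = 0\<^sub>m n n"
    unfolding jordan_block_zero_pow by (intro eq_matI) auto
  then show ?thesis
    using dim_kernel_zero_jordan_block_pow[of n n, where 'a = 'a] by (simp add: kernel_dim_def)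
qed

lemma jordan_nf_dim:
  assumes "X \<in> carrier_mat n n" "jordan_nf X n_as"
  shows "sum_list (map fst n_as) = n"
proof -
  from assms(2) have "similar_mat X (jordan_matrix n_as)" by (simp add: jordan_nf_def)
  then obtain k where "X \<in> carrier_mat k k" "jordan_matrix n_as \<in> carrier_mat k k"
    by (blast dest: similar_matD)
  then show ?thesis using assms(1) by (metis carrier_matD(1) jordan_matrix_dim(1))
qed

text \<open>The kernel of \<open>X\<^sup>k = 0\<close> is the whole space. A block of size \<open>m\<close> contributes \<open>min k m\<close> to
  its dimension if the eigenvalue is 0, and nothing otherwise; for the total to reach the sum of all
  sizes, no block may fall short of its size.\<close>
lemma nilpotent_jordan_blocks:
  fixes X :: "'a :: field mat"
  assumes X: "X \<in> carrier_mat n n" "X ^\<^sub>m k = 0\<^sub>m n n" and jnf: "jordan_nf X n_as"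
    and mem: "(m, e) \<in> set n_as"
  shows "e = 0 \<and> m \<le> k"
proof -
  have le: "(\<Sum>m\<leftarrow>map fst [(m, e)\<leftarrow>n_as. e = 0]. min k m) \<le> sum_list (map fst n_as)" for n_as :: "(nat \<times> 'a) list"
    by (induction n_as) auto
  have strict: "(\<Sum>m\<leftarrow>map fst [(m, e)\<leftarrow>n_as. e = 0]. min k m) < sum_list (map fst n_as)"
    if "(m, e) \<in> set n_as" "e \<noteq> 0 \<or> k < m" "m \<noteq> 0" for n_as :: "(nat \<times> 'a) list"
    using that
  proof (induction n_as)
    case (Cons a n_as)
    show ?case
    proof (cases "a = (m, e)")
      case True
      then show ?thesis using le[of n_as] Cons.prems by auto
    next
      case False
      then have "(\<Sum>m\<leftarrow>map fst [(m, e)\<leftarrow>n_as. e = 0]. min k m) < sum_list (map fst n_as)"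
        using Cons by auto
      then show ?thesis by (cases a) auto
    qed
  qed simp
  have "(\<Sum>m\<leftarrow>map fst [(m, e)\<leftarrow>n_as. e = 0]. min k m) = sum_list (map fst n_as)"
    using dim_gen_eigenspace[OF jnf, of 0 k] jordan_nf_dim[OF X(1) jnf]
    by (simp add: dim_gen_eigenspace_zero[OF X(1)] X(2) kernel_dim_zero_mat)
  moreover have "m \<noteq> 0" using jnf mem by (force simp: jordan_nf_def)
  ultimately show ?thesis using strict[OF mem] by force
qed

lemma kernel_dim_nilpotent_power:
  fixes X :: "'a :: field mat"
  assumes X: "X \<in> carrier_mat n n" "X ^\<^sub>m k = 0\<^sub>m n n" and jnf: "jordan_nf X n_as"
  shows "kernel_dim (X ^\<^sub>m j) = (\<Sum>m\<leftarrow>map fst n_as. min j m)"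
proof -
  have "[(m, e)\<leftarrow>n_as. e = 0] = n_as"
    using nilpotent_jordan_blocks[OF X jnf] by (intro filter_True) blast
  then show ?thesis
    using dim_gen_eigenspace[OF jnf, of 0 j] dim_gen_eigenspace_zero[OF X(1), of j] by simp
qed

text \<open>The three conclusions belong together: the last two equations can be solved for \<open>p\<close> and
  \<open>q\<close>, which makes the kernel dimension a complete invariant of square-zero matrices of a given size.\<close>
lemma square_zero_jordan_nf:
  fixes X :: "complex mat"
  assumes X: "X \<in> carrier_mat n n" "X ^\<^sub>m 2 = 0\<^sub>m n n"
  obtains p q where "jordan_nf X (replicate p (2, 0) @ replicate q (1, 0))"
    "n = 2 * p + q" "kernel_dim X = p + q"
proof -
  obtain n_as where jnf: "jordan_nf X n_as"
    using segre_characteristic_exists[OF X(1)] by blast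
  define p where "p = count (mset n_as) (2, 0)"
  define q where "q = count (mset n_as) (1, 0)"
  have mem: "a = (2, 0) \<or> a = (1, 0)" if "a \<in> set n_as" for a
  proof -
    obtain m e where a: "a = (m, e)" by force
    have "m \<noteq> 0" using jnf that by (force simp: jordan_nf_def a)
    then show ?thesis using nilpotent_jordan_blocks[OF X jnf, of m e] that a by auto
  qed
  have "mset n_as = mset (replicate p (2, 0) @ replicate q (1, 0))"
  proof (rule multiset_eqI)
    fix a
    show "count (mset n_as) a = count (mset (replicate p (2, 0) @ replicate q (1, 0))) a"
      using mem[of a] by (cases "a \<in> set n_as") (auto simp: p_def q_def count_mset_0_iff)
  qed
  then have jnf': "jordan_nf X (replicate p (2, 0) @ replicate q (1, 0))"
    by (rule jordan_nf_mset[OF jnf])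
  moreover have "n = 2 * p + q"
    using jordan_nf_dim[OF X(1) jnf'] by (simp add: sum_list_replicate)
  moreover have "X ^\<^sub>m 1 = X" using X(1) by simp
  then have "kernel_dim X = p + q"
    using kernel_dim_nilpotent_power[OF X jnf', of 1] by (simp add: sum_list_replicate)
  ultimately show ?thesis using that by blast
qed

lemma square_zero_similar:
  fixes X Y :: "complex mat"
  assumes X: "X \<in> carrier_mat n n" "X ^\<^sub>m 2 = 0\<^sub>m n n"
    and Y: "Y \<in> carrier_mat n n" "Y ^\<^sub>m 2 = 0\<^sub>m n n"
    and ker: "kernel_dim X = kernel_dim Y"
  shows "similar_mat X Y"
proof -
  obtain p q where pq: "jordan_nf X (replicate p (2, 0) @ replicate q (1, 0))"
    "n = 2 * p + q" "kernel_dim X = p + q" using square_zero_jordan_nf[OF X] .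
  obtain p' q' where pq': "jordan_nf Y (replicate p' (2, 0) @ replicate q' (1, 0))"
    "n = 2 * p' + q'" "kernel_dim Y = p' + q'" using square_zero_jordan_nf[OF Y] .
  have "p' = p \<and> q' = q" using pq pq' ker by linarith
  then show ?thesis
    using pq(1) pq'(1) similar_mat_trans similar_mat_sym unfolding jordan_nf_def by blast
qed

lemma pow_mat_square_square:
  fixes A :: "'a :: comm_ring_1 mat"
  assumes "A \<in> carrier_mat n n"
  shows "(A ^\<^sub>m 2) ^\<^sub>m 2 = A ^\<^sub>m 4"
proof -
  have [simp]: "A ^\<^sub>m 2 = A * A" "A ^\<^sub>m 4 = A * A * A * A"
    using assms by (simp_all add: eval_nat_numeral)
  have "(A * A) ^\<^sub>m 2 = (A * A) * (A * A)"
    using assms by (simp add: eval_nat_numeral)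
  then show ?thesis using assms by (simp add: assoc_mult_mat[of _ n n _ n _ n])
qed

section \<open>Square roots of square-zero matrices\<close>

lemma jordan_matrix_nilpotent:
  fixes n_as :: "(nat \<times> 'a :: comm_ring_1) list"
  assumes "\<And>m e. (m, e) \<in> set n_as \<Longrightarrow> e = 0 \<and> m \<le> k"
  shows "jordan_matrix n_as ^\<^sub>m k =
    0\<^sub>m (sum_list (map fst n_as)) (sum_list (map fst n_as))"
  using assms
proof (induction n_as)
  case Nil
  show ?case unfolding jordan_matrix_pow by simp
next
  case (Cons a n_as)
  obtain m where a: "a = (m, 0)" and m: "m \<le> k"
    using Cons.prems by (cases a) auto
  have "jordan_block m (0 :: 'a) ^\<^sub>m k = 0\<^sub>m m m"
    using m unfolding jordan_block_pow by (intro eq_matI) (auto simp: power_0_left)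
  moreover have "jordan_matrix n_as ^\<^sub>m k =
      0\<^sub>m (sum_list (map fst n_as)) (sum_list (map fst n_as))"
    by (rule Cons.IH) (rule Cons.prems, simp)
  ultimately show ?case unfolding jordan_matrix_pow by (simp add: a Let_def)
qed

lemma similar_square_has_square_root:
  assumes X: "X \<in> carrier_mat n n" and sim: "similar_mat X (M ^\<^sub>m 2)" and M: "M \<in> carrier_mat n n"
  shows "\<exists>A. is_square_root A X"
proof -
  obtain P Q where "similar_mat_wit X (M ^\<^sub>m 2) P Q" using sim by (auto simp: similar_mat_def)
  note w = similar_mat_witD2[OF X this]
  have "similar_mat_wit (P * M * Q) M P Q"
    by (rule similar_mat_witI[OF w(1,2) refl _ M w(6,7)]) (use M w in auto)
  then have "(P * M * Q) ^\<^sub>m 2 = X" using w(3) by (simp add: similar_mat_wit_pow_id)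
  then show ?thesis using X M w by (intro exI[of _ "P * M * Q"]) (auto simp: is_square_root_def)
qed

text \<open>For \<open>m \<le> 4\<close>, the bound \<open>m \<le> 2 min 2 m\<close> is an equality only for 0 and 4, so equality of the
  sums forces all entries to be 0 or 4.\<close>
lemma sum_list_twice_min:
  fixes ms :: "nat list"
  assumes "\<And>m. m \<in> set ms \<Longrightarrow> m \<le> 4"
  shows "sum_list ms \<le> 2 * (\<Sum>m\<leftarrow>ms. min 2 m) \<and>
    (sum_list ms = 2 * (\<Sum>m\<leftarrow>ms. min 2 m) \<longrightarrow> 4 dvd sum_list ms)"
  using assms
proof (induction ms)
  case (Cons m ms)
  have IH: "sum_list ms \<le> 2 * (\<Sum>m\<leftarrow>ms. min 2 m)"
    "sum_list ms = 2 * (\<Sum>m\<leftarrow>ms. min 2 m) \<Longrightarrow> 4 dvd sum_list ms" using Cons by auto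
  have m: "m \<le> 2 * min 2 m" "m = 2 * min 2 m \<Longrightarrow> 4 dvd m"
    using Cons.prems[of m] by (auto simp: min_def split: if_splits)
  show ?case
  proof (intro conjI impI)
    show "sum_list (m # ms) \<le> 2 * (\<Sum>m\<leftarrow>m # ms. min 2 m)" using m(1) IH(1) by simp
    assume "sum_list (m # ms) = 2 * (\<Sum>m\<leftarrow>m # ms. min 2 m)"
    then have "m = 2 * min 2 m" "sum_list ms = 2 * (\<Sum>m\<leftarrow>ms. min 2 m)"
      using m(1) IH(1) by (simp_all only: sum_list.Cons list.map distrib_left)
    then show "4 dvd sum_list (m # ms)" using m(2) IH(2) by (simp only: sum_list.Cons dvd_add)
  qed
qed simp

text \<open>If there are no blocks of size 1, the kernel of \<open>A\<^sup>2\<close> is half of the space. This is the least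
  possible dimension for \<open>A\<^sup>4 = 0\<close>, attained only if all Jordan blocks of \<open>A\<close> have size 4.\<close>
lemma square_root_imp_parity:
  assumes X: "X \<in> carrier_mat n n" "X ^\<^sub>m 2 = 0\<^sub>m n n"
    and n: "n = 2 * p + q" and ker: "kernel_dim X = p + q"
    and root: "is_square_root A X"
  shows "even p \<or> q \<ge> 1"
proof (cases "q = 0")
  case True
  have A: "A \<in> carrier_mat n n" "A ^\<^sub>m 2 = X" using root X by (auto simp: is_square_root_def)
  have nil: "A ^\<^sub>m 4 = 0\<^sub>m n n" using pow_mat_square_square[OF A(1)] A(2) X(2) by simp
  obtain n_as where jnf: "jordan_nf A n_as" using segre_characteristic_exists[OF A(1)] by blast
  let ?ms = "map fst n_as"
  have le: "m \<le> 4" if "m \<in> set ?ms" for m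
    using nilpotent_jordan_blocks[OF A(1) nil jnf] that by auto
  have "sum_list ?ms = 2 * (\<Sum>m\<leftarrow>?ms. min 2 m)"
    using kernel_dim_nilpotent_power[OF A(1) nil jnf, of 2] jordan_nf_dim[OF A(1) jnf]
      A(2) n ker True by simp
  with sum_list_twice_min[of ?ms, OF le] have "4 dvd sum_list ?ms" by blast
  then have "4 dvd 2 * p" unfolding jordan_nf_dim[OF A(1) jnf] n True by simp
  then show ?thesis by presburger
qed simp

text \<open>The parity condition says that \<open>p\<close> twos and \<open>q\<close> ones can be grouped into \<open>i\<close> pairs \<open>(2,2)\<close>,
  \<open>j\<close> pairs \<open>(2,1)\<close> and \<open>k\<close> single ones. Such a grouping gives both a square root and a Segre
  pairing.\<close>
lemma parity_decomposition:
  fixes p q :: nat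
  assumes "even p \<or> q \<ge> 1"
  obtains i j k where "p = 2 * i + j" "q = j + k"
proof (cases "even p")
  case True
  then show ?thesis using that[of "p div 2" 0 q] by simp
next
  case False
  then show ?thesis using that[of "p div 2" 1 "q - 1"] assms by simp
qed

text \<open>The nilpotent blocks of sizes 4, 3 and 1 have squares of Jordan types \<open>(2,2)\<close>, \<open>(2,1)\<close> and
  \<open>(1)\<close>. Comparing kernel dimensions replaces the explicit computation of these Jordan forms.\<close>
lemma parity_imp_square_root:
  assumes X: "X \<in> carrier_mat n n" "X ^\<^sub>m 2 = 0\<^sub>m n n"
    and n: "n = 2 * p + q" and ker: "kernel_dim X = p + q"
    and parity: "even p \<or> q \<ge> 1"
  shows "\<exists>A. is_square_root A X"
proof -
  obtain i j k where ijk: "p = 2 * i + j" "q = j + k"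
    using parity_decomposition[OF parity] .
  define n_as :: "(nat \<times> complex) list" where
    "n_as = replicate i (4, 0) @ replicate j (3, 0) @ replicate k (1, 0)"
  define M where "M = jordan_matrix n_as"
  have dim: "sum_list (map fst n_as) = n"
    by (simp add: n_as_def sum_list_replicate n ijk)
  have M: "M \<in> carrier_mat n n" unfolding M_def using jordan_matrix_carrier[of n_as] dim by simp
  have jnf: "jordan_nf M n_as"
    using similar_mat_refl[OF M] by (auto simp: jordan_nf_def M_def n_as_def)
  have "e = 0 \<and> m \<le> 4" if "(m, e) \<in> set n_as" for m e
    using that by (auto simp: n_as_def)
  from jordan_matrix_nilpotent[OF this] have nil: "M ^\<^sub>m 4 = 0\<^sub>m n n"
    by (simp add: M_def dim)
  have "kernel_dim (M ^\<^sub>m 2) = p + q"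
    unfolding kernel_dim_nilpotent_power[OF M nil jnf]
    by (simp add: n_as_def sum_list_replicate ijk)
  then have "similar_mat X (M ^\<^sub>m 2)"
    using X M nil ker pow_mat_square_square[OF M] by (intro square_zero_similar) auto
  then show ?thesis by (rule similar_square_has_square_root[OF X(1) _ M])
qed

section \<open>Segre pairings\<close>

lemma segre_characteristic_square_zero:
  assumes "jordan_nf X (replicate p (2, 0) @ replicate q (1, 0))"
  shows "segre_characteristic X = replicate p 2 @ replicate q 1"
proof -
  have "sort (replicate p (2::nat) @ replicate q 1) = replicate q 1 @ replicate p 2"
    by (rule properties_for_sort) (auto simp: sorted_append sorted_replicate)
  then show ?thesis using segre_characteristic_eq[OF assms] by simp
qed

lemma segre_pairing_iff_parity:
  assumes ns: "segre_characteristic X = replicate p 2 @ replicate q 1"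
  shows "(\<exists>ps. segre_pairing X ps) \<longleftrightarrow> even p \<or> q \<ge> 1"
proof
  assume "\<exists>ps. segre_pairing X ps"
  then obtain ps where ps: "segre_pairing X ps" ..
  show "even p \<or> q \<ge> 1"
  proof (rule disjCI)
    assume q: "\<not> q \<ge> 1"
    \<comment> \<open>The pair \<open>(2,0)\<close> is excluded by the difference condition, so each 2 is paired with a 2.\<close>
    have "x = (2, 2)" if "x \<in> set ps" for x
      using ps that q by (cases x) (force simp: segre_pairing_def Let_def ns)
    then obtain k where k: "ps = replicate k (2, 2)"
      by (metis replicate_length_same)
    have "mset (replicate (2 * k) (2 :: nat)) = mset (replicate p 2)"
      using ps q unfolding segre_pairing_def Let_def ns k
      by (simp add: mult_2 replicate_add)
    then have "2 * k = p" by (metis length_replicate size_mset)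
    then show "even p" by auto
  qed
next
  assume parity: "even p \<or> q \<ge> 1"
  obtain i j k where ijk: "p = 2 * i + j" "q = j + k"
    using parity_decomposition[OF parity] .
  let ?ps = "replicate i (2, 2) @ replicate j (2, 1) @ replicate k (1, 0) :: (nat \<times> nat) list"
  have srt: "sorted_wrt R (replicate m x)" if "R x x" for R :: "nat \<times> nat \<Rightarrow> _" and x m
    using that by (induction m) auto
  have "segre_pairing X ?ps"
    unfolding segre_pairing_def Let_def ns ijk
    by (auto simp: sorted_wrt_append srt mult_2 replicate_add)
  then show "\<exists>ps. segre_pairing X ps" ..
qed

section \<open>Equivalence of square roots, Segre pairings and the parity condition\<close>

theorem theorem3p2:
  fixes n :: nat and H B\<^sub>0 :: "complex mat"
  assumes "H \<in> carrier_mat n n" and "invertible_mat H" and "hermitian_mat H"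
    and "B\<^sub>0 \<in> carrier_mat n n" and "nilpotent_mat B\<^sub>0" and "H_nonnegative H B\<^sub>0"
  shows "((\<exists>A. is_square_root A B\<^sub>0) \<longleftrightarrow> (\<exists>ps. segre_pairing B\<^sub>0 ps))
    \<and> ((\<exists>ps. segre_pairing B\<^sub>0 ps) \<longleftrightarrow>
        (even (count_list (segre_characteristic B\<^sub>0) 2)
         \<or> odd (count_list (segre_characteristic B\<^sub>0) 2)
           \<and> count_list (segre_characteristic B\<^sub>0) 1 \<ge> 1))"
proof -
  note B = assms(4) nilpotent_H_nonnegative_square_zero[OF assms]
  obtain p q where pq: "jordan_nf B\<^sub>0 (replicate p (2, 0) @ replicate q (1, 0))"
    "n = 2 * p + q" "kernel_dim B\<^sub>0 = p + q"
    using square_zero_jordan_nf[OF B] .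
  note ns = segre_characteristic_square_zero[OF pq(1)]
  have count: "count_list (replicate m x) y = (if x = y then m else 0)" for m and x y :: nat
    by (induction m) auto
  have "(\<exists>A. is_square_root A B\<^sub>0) \<longleftrightarrow> even p \<or> q \<ge> 1"
    using square_root_imp_parity[OF B pq(2,3)] parity_imp_square_root[OF B pq(2,3)] by blast
  then show ?thesis
    unfolding segre_pairing_iff_parity[OF ns] unfolding ns by (auto simp: count)
qed

end
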